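(* Let $(\hat\lambda_i,\hat\alpha_i)_i$ be the eigensystem (eigenvalues and orthonormal eigenvectors) of the $s\times s$ matrix $\frac1s\tilde{\boldsymbol H}_s^{1/2}K_s\tilde{\boldsymbol H}_s^{1/2}$, where $K_s=[K(Y^0_i,Y^0_j)]_{i,j\in[s]}$, $\boldsymbol H_s=\boldsymbol I_s-\frac1s\boldsymbol 1_s\boldsymbol 1_s^\top$ and $\tilde{\boldsymbol H}_s=\frac s{s-1}\boldsymbol H_s$. Define $$G=\sum_{i:\hat\lambda_i\neq0}\left(\frac{g_\lambda(\hat\lambda_i)-g_\lambda(0)}{\hat\lambda_i}\right)\hat\alpha_i\hat\alpha_i^\top .$$ Then $$\hat\eta^{TS}_\lambda=\frac1{n(n-1)}\big(T_1-T_2\big)+\frac1{m(m-1)}\big(T_3-T_4\big)-\frac2{nm}T_5,$$ where $$T_1=\boldsymbol 1_n^\top A_n\boldsymbol 1_n,\quad T_2=\mathrm{Tr}(A_n),\quad A_n=g_\lambda(0)K_n+\tfrac1sK_{ns}\tilde{\boldsymbol H}_s^{1/2}G\tilde{\boldsymbol H}_s^{1/2}K_{ns}^\top,$$ $$T_3=\boldsymbol 1_m^\top A_m\boldsymbol 1_m,\quad T_4=\mathrm{Tr}(A_m),\quad A_m=g_\lambda(0)K_m+\tfrac1sK_{ms}\tilde{\boldsymbol H}_s^{1/2}G\tilde{\boldsymbol H}_s^{1/2}K_{ms}^\top,$$ $$T_5=\boldsymbol 1_m^\top\Big(g_\lambda(0)K_{mn}+\tfrac1sK_{ms}\tilde{\boldsymbol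 H}_s^{1/2}G\tilde{\boldsymbol H}_s^{1/2}K_{ns}^\top\Big)\boldsymbol 1_n,$$ with $K_n=[K(X_i,X_j)]_{i,j\in[n]}$, $K_m=[K(X^0_i,X^0_j)]_{i,j\in[m]}$, $K_{ns}=[K(X_i,Y^0_j)]_{i\in[n],j\in[s]}$, $K_{ms}=[K(X^0_i,Y^0_j)]_{i\in[m],j\in[s]}$, $K_{mn}=[K(X^0_i,X_j)]_{i\in[m],j\in[n]}$.
   Context: $\mathscr H$ is a separable RKHS of real functions on a second countable space $\mathcal X$ with continuous bounded reproducing kernel $K$. $X_1,\dots,X_n$, $X^0_1,\dots,X^0_m$, $Y^0_1,\dots,Y^0_s$ are points of $\mathcal X$ (data), $n,m,s\ge2$. $[\ell]=\{1,\dots,\ell\}$, $\boldsymbol 1_\ell\in\mathbb R^\ell$ is the all-ones vector, $\boldsymbol I_\ell$ the identity matrix. For each $\lambda>0$, $g_\lambda$ is a positive function on $[0,\infty)$. For a compact self-adjoint positive operator $\mathcal B=\sum_i\tau_i\psi_i\otimes\psi_i$ on $\mathscr H$, $g_\lambda(\mathcal B)=\sum_ig_\lambda(\tau_i)\psi_i\otimes\psi_i+g_\lambda(0)(I-\sum_i\psi_i\otimes\psi_i)$, and $g_\lambda^{1/2}(\mathcal B)$ is its square root. The empirical covariance operator is $\hat\Sigma_0=\frac1{2s(s-1)}\sum_{i\ne j}(K(\cdot,Y^0_i)-K(\cdot,Y^0_j))\otimes_{\mathscr H}(K(\cdot,Y^0_i)-K(\cdot,Y^0_j))$. The two-sample statistic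 is $$\hat\eta^{TS}_\lambda=\frac1{n(n-1)}\frac1{m(m-1)}\sum_{1\le i\ne j\le n}\ \sum_{1\le i'\ne j'\le m}\big\langle g_\lambda^{1/2}(\hat\Sigma_0)(K(\cdot,X_i)-K(\cdot,X^0_{i'})),\,g_\lambda^{1/2}(\hat\Sigma_0)(K(\cdot,X_j)-K(\cdot,X^0_{j'}))\big\rangle_{\mathscr H}.$$ *)

theory Defs
  imports "HOL-Analysis.Analysis"
begin

text \<open>
  A Hilbert space of real functions on \<^typ>\<open>'x\<close> is given by a Hilbert space type \<^typ>\<open>'h\<close> together
  with an injective map \<open>ev\<close> sending an element to the function it stands for, with pointwise
  linear structure.
\<close>

definition rkhs :: "('h::{real_inner,complete_space} \<Rightarrow> 'x \<Rightarrow> real) \<Rightarrow> ('x \<Rightarrow> 'x \<Rightarrow> real) \<Rightarrow> bool" where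
  "rkhs ev K \<longleftrightarrow>
     inj ev \<and> (\<forall>x. linear (\<lambda>f. ev f x)) \<and>
     (\<forall>x. \<exists>k. ev k = (\<lambda>y. K y x) \<and> (\<forall>f. inner f k = ev f x))"

definition kernel_section :: "('h \<Rightarrow> 'x \<Rightarrow> real) \<Rightarrow> ('x \<Rightarrow> 'x \<Rightarrow> real) \<Rightarrow> 'x \<Rightarrow> 'h" where
  "kernel_section ev K x = (THE k. ev k = (\<lambda>y. K y x))"

definition tensor_op :: "'h::real_inner \<Rightarrow> 'h \<Rightarrow> 'h \<Rightarrow> 'h" where
  "tensor_op a b = (\<lambda>f. inner b f *\<^sub>R a)"

text \<open>
  Only the nonzero spectrum is listed, so that \<open>\<psi>\<close> is an orthonormal basis of the closure of the
  range of \<open>B\<close>; \<open>I\<close> may be finite or infinite, and the series converges in the strong sense.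
\<close>

definition spectral_rep ::
  "('h::real_inner \<Rightarrow> 'h) \<Rightarrow> nat set \<Rightarrow> (nat \<Rightarrow> real) \<Rightarrow> (nat \<Rightarrow> 'h) \<Rightarrow> bool" where
  "spectral_rep B I \<tau> \<psi> \<longleftrightarrow>
     (\<forall>i\<in>I. \<tau> i > 0) \<and>
     (\<forall>i\<in>I. \<forall>j\<in>I. inner (\<psi> i) (\<psi> j) = (if i = j then 1 else 0)) \<and>
     (\<forall>f. ((\<lambda>i. \<tau> i *\<^sub>R tensor_op (\<psi> i) (\<psi> i) f) has_sum B f) I)"

text \<open>
  The representation is unique only up to the choice of orthonormal bases of the eigenspaces and
  the enumeration; the resulting operator does not depend on that choice.
\<close>

definition op_fun :: "(real \<Rightarrow> real) \<Rightarrow> ('h::real_inner \<Rightarrow> 'h) \<Rightarrow> 'h \<Rightarrow> 'h" where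
  "op_fun \<phi> B =
     (let (I, \<tau>, \<psi>) = (SOME (I, \<tau>, \<psi>). spectral_rep B I \<tau> \<psi>)
      in (\<lambda>f. (\<Sum>\<^sub>\<infinity>i\<in>I. \<phi> (\<tau> i) *\<^sub>R tensor_op (\<psi> i) (\<psi> i) f)
            + \<phi> 0 *\<^sub>R (f - (\<Sum>\<^sub>\<infinity>i\<in>I. tensor_op (\<psi> i) (\<psi> i) f))))"

definition op_sqrt :: "('h::real_inner \<Rightarrow> 'h) \<Rightarrow> 'h \<Rightarrow> 'h" where
  "op_sqrt A =
     (THE C. bounded_linear C \<and> (\<forall>x y. inner (C x) y = inner x (C y)) \<and>
             (\<forall>x. inner x (C x) \<ge> 0) \<and> C \<circ> C = A)"

definition emp_cov ::
  "('h::real_inner \<Rightarrow> 'x \<Rightarrow> real) \<Rightarrow> ('x \<Rightarrow> 'x \<Rightarrow> real) \<Rightarrow> ('s::finite \<Rightarrow> 'x) \<Rightarrow> 'h \<Rightarrow> 'h" where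
  "emp_cov ev K Y = (\<lambda>f.
     (1 / (2 * real CARD('s) * (real CARD('s) - 1))) *\<^sub>R
     (\<Sum>(i, j)\<in>{(i, j). i \<noteq> j}.
        tensor_op (kernel_section ev K (Y i) - kernel_section ev K (Y j))
                  (kernel_section ev K (Y i) - kernel_section ev K (Y j)) f))"

definition eta_TS ::
  "('h::real_inner \<Rightarrow> 'x \<Rightarrow> real) \<Rightarrow> ('x \<Rightarrow> 'x \<Rightarrow> real) \<Rightarrow> (real \<Rightarrow> real) \<Rightarrow>
   ('n::finite \<Rightarrow> 'x) \<Rightarrow> ('m::finite \<Rightarrow> 'x) \<Rightarrow> ('s::finite \<Rightarrow> 'x) \<Rightarrow> real" where
  "eta_TS ev K \<phi> X X0 Y0 =
     (let S = op_sqrt (op_fun \<phi> (emp_cov ev K Y0)); k = kernel_section ev K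
      in 1 / (real CARD('n) * (real CARD('n) - 1)) * (1 / (real CARD('m) * (real CARD('m) - 1))) *
         (\<Sum>(i, j)\<in>{(i, j). i \<noteq> j}. \<Sum>(i', j')\<in>{(i', j'). i' \<noteq> j'}.
            inner (S (k (X i) - k (X0 i'))) (S (k (X j) - k (X0 j')))))"

definition gram :: "('x \<Rightarrow> 'x \<Rightarrow> real) \<Rightarrow> ('a::finite \<Rightarrow> 'x) \<Rightarrow> ('b::finite \<Rightarrow> 'x) \<Rightarrow> real ^ 'b ^ 'a" where
  "gram K U V = (\<chi> i j. K (U i) (V j))"

definition outer :: "real ^ 'a \<Rightarrow> real ^ 'b \<Rightarrow> real ^ 'b ^ 'a" where
  "outer u v = (\<chi> i j. u $ i * v $ j)"

definition matrix_sqrt :: "real ^ 's ^ 's \<Rightarrow> real ^ 's ^ 's" where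
  "matrix_sqrt A = (THE B. transpose B = B \<and> (\<forall>v. inner v (B *v v) \<ge> 0) \<and> B ** B = A)"

text \<open>In \<open>\<real>\<^sup>s\<close>, \<^term>\<open>1 :: real ^ 's\<close> is the all-ones vector and \<^term>\<open>mat 1 :: real ^ 's ^ 's\<close> the identity.\<close>

definition centering :: "real ^ 's ^ 's" where
  "centering = mat 1 - (1 / real CARD('s)) *\<^sub>R outer 1 1"

definition scaled_centering :: "real ^ 's ^ 's" where
  "scaled_centering = (real CARD('s) / (real CARD('s) - 1)) *\<^sub>R centering"

definition eigensystem :: "real ^ 's ^ 's \<Rightarrow> ('s \<Rightarrow> real) \<Rightarrow> ('s \<Rightarrow> real ^ 's) \<Rightarrow> bool" where
  "eigensystem M \<mu> v \<longleftrightarrow>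
     (\<forall>i. M *v v i = \<mu> i *\<^sub>R v i) \<and>
     (\<forall>i j. inner (v i) (v j) = (if i = j then 1 else 0))"

end

theory Submission
  imports Defs
begin

text \<open>
  Let \<open>R\<close> be the square root of the scaled centering matrix and \<open>u\<^sub>i = \<Sum>\<^sub>a (R \<alpha>\<^sub>i)\<^sub>a K(\<cdot>, Y\<^sub>a)\<close>. Since \<open>\<alpha>\<close> is an eigensystem of
  \<open>R K\<^sub>s R / s\<close>, the \<open>u\<^sub>i\<close> are orthogonal with squared norm \<open>s \<lambda>\<^sub>i\<close>; since it is an orthonormal basis
  of \<open>\<real>\<^sup>s\<close>, the empirical covariance is \<open>\<Sum>\<^sub>i u\<^sub>i \<otimes> u\<^sub>i / s\<close>. Normalising the nonzero \<open>u\<^sub>i\<close> thus diagonalises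
  it, so that applying \<open>g\<close> to the covariance gives \<open>g(0) + \<Sum>\<^sub>i (g(\<lambda>\<^sub>i) - g(0)) / (s \<lambda>\<^sub>i) u\<^sub>i \<otimes> u\<^sub>i\<close>, whose matrix
  entries between kernel sections are those of the matrices in the theorem. The rest is
  expanding a bilinear form over off-diagonal index pairs.

  A positive square root, and likewise the functional calculus, is pinned down by its values on
  eigenvectors: \<open>C\<^sup>2 f = a f\<close> forces \<open>C f = \<surd>a f\<close>, because \<open>C f - \<surd>a f\<close> lies in the eigenspace of
  \<open>C\<close> for \<open>- \<surd>a\<close>.
\<close>


section \<open>Operators with finitely many eigenvalues\<close>

lemma psd_root_eigenvector:
  fixes C :: "'h::real_inner \<Rightarrow> 'h"
  assumes lin: "linear C" and sym: "\<And>x y. inner (C x) y = inner x (C y)"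
    and pos: "\<And>x. inner x (C x) \<ge> 0" and eig: "C (C f) = a *\<^sub>R f" and a: "a \<ge> 0"
  shows "C f = sqrt a *\<^sub>R f"
\<comment> \<open>For \<open>a = 0\<close> the eigenvalue \<open>- sqrt a\<close> is not negative
  and positivity says nothing; symmetry then gives the squared norm of \<open>C f\<close> as
  \<open>inner f (C (C f)) = 0\<close>.\<close>
proof (cases "a = 0")
  case True
  have "inner (C f) (C f) = inner f (C (C f))"
    by (rule sym)
  then show ?thesis
    using eig True by simp
next
  case False
  define y where "y = C f - sqrt a *\<^sub>R f"
  have "C y = - sqrt a *\<^sub>R y"
    using a by (simp add: y_def linear_diff[OF lin] linear_cmul[OF lin] eig algebra_simps)
  then have "sqrt a * inner y y \<le> 0"
    using pos[of y] by simp
  moreover have "sqrt a > 0"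
    using a False by simp
  ultimately have "y = 0"
    by (metis inner_eq_zero_iff inner_ge_zero mult_le_0_iff order_antisym order_less_le_trans
        less_irrefl)
  then show ?thesis
    by (simp add: y_def)
qed

section \<open>Multiples of the identity modified along finitely many orthonormal directions\<close>

definition orthonormal_on :: "'i set \<Rightarrow> ('i \<Rightarrow> 'h::real_inner) \<Rightarrow> bool" where
  "orthonormal_on I \<psi> \<longleftrightarrow> (\<forall>i\<in>I. \<forall>j\<in>I. inner (\<psi> i) (\<psi> j) = (if i = j then 1 else 0))"

text \<open>Diagonal with value \<open>c i\<close> on \<open>\<psi> i\<close> and \<open>c0\<close>
  on the orthogonal complement. Written as a finite-rank correction of \<open>c0\<close> times the
  identity, so that boundedness and symmetry can be read off termwise.\<close>

definition spectral_op ::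
  "real \<Rightarrow> 'i set \<Rightarrow> ('i \<Rightarrow> real) \<Rightarrow> ('i \<Rightarrow> 'h::real_inner) \<Rightarrow> 'h \<Rightarrow> 'h" where
  "spectral_op c0 I c \<psi> f = c0 *\<^sub>R f + (\<Sum>i\<in>I. ((c i - c0) * inner (\<psi> i) f) *\<^sub>R \<psi> i)"

text \<open>The Kronecker delta collapses the sum. The general \<open>v\<close> covers both vector
  expansions (\<open>v = \<psi>\<close>) and scalar ones (\<open>v = 1\<close>).\<close>

lemma orthonormal_on_sum:
  fixes v :: "'i \<Rightarrow> 'v::real_vector"
  assumes "orthonormal_on I \<psi>" "finite I" "j \<in> I"
  shows "(\<Sum>i\<in>I. (a i * inner (\<psi> i) (\<psi> j)) *\<^sub>R v i) = a j *\<^sub>R v j"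
proof -
  have "(\<Sum>i\<in>I. (a i * inner (\<psi> i) (\<psi> j)) *\<^sub>R v i) = (\<Sum>i\<in>I. if i = j then a j *\<^sub>R v j else 0)"
    using assms by (intro sum.cong) (auto simp: orthonormal_on_def)
  with assms show ?thesis by simp
qed

lemma spectral_op_basis:
  assumes "orthonormal_on I \<psi>" "finite I" "j \<in> I"
  shows "spectral_op c0 I c \<psi> (\<psi> j) = c j *\<^sub>R \<psi> j"
  using orthonormal_on_sum[OF assms, of "\<lambda>i. c i - c0" \<psi>]
  by (simp add: spectral_op_def algebra_simps)

lemma spectral_op_orthogonal:
  assumes "\<And>i. i \<in> I \<Longrightarrow> inner (\<psi> i) f = 0"
  shows "spectral_op c0 I c \<psi> f = c0 *\<^sub>R f"
  using assms by (simp add: spectral_op_def)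

lemma linear_spectral_op: "linear (spectral_op c0 I c \<psi>)"
  by (rule linearI)
    (simp_all add: spectral_op_def inner_add_right distrib_left scaleR_add_left scaleR_add_right
      sum.distrib scaleR_sum_right mult.left_commute)

lemma bounded_linear_spectral_op: "bounded_linear (spectral_op c0 I c \<psi>)"
  unfolding spectral_op_def
  by (intro bounded_linear_add bounded_linear_scaleR_right bounded_linear_sum
      bounded_linear_scaleR_const bounded_linear_const_mult bounded_linear_inner_right)

lemma spectral_op_sym:
  "inner (spectral_op c0 I c \<psi> f) h = inner f (spectral_op c0 I c \<psi> h)"
  by (simp add: spectral_op_def inner_add_left inner_add_right inner_sum_left inner_sum_right
      inner_commute mult.commute mult.left_commute)

text \<open>Every vector is a finite combination of the \<open>\<psi> i\<close> plus a vector
  orthogonal to all of them, so values on these two kinds determine a linear map. This is the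
  uniqueness principle behind compositions, square roots and the functional calculus.\<close>

lemma linear_eq_spectral_op:
  assumes lin: "linear C" and on: "orthonormal_on I \<psi>" and fin: "finite I"
    and basis: "\<And>j. j \<in> I \<Longrightarrow> C (\<psi> j) = c j *\<^sub>R \<psi> j"
    and orth: "\<And>f. (\<And>i. i \<in> I \<Longrightarrow> inner (\<psi> i) f = 0) \<Longrightarrow> C f = c0 *\<^sub>R f"
  shows "C = spectral_op c0 I c \<psi>"
proof
  fix f
  \<comment> \<open>The orthogonal projection of \<open>f\<close> onto the span of the
    \<open>\<psi> i\<close>.\<close>
  define p where "p = (\<Sum>i\<in>I. inner (\<psi> i) f *\<^sub>R \<psi> i)"
  have "inner (\<psi> j) p = inner (\<psi> j) f" if "j \<in> I" for j
    using orthonormal_on_sum[OF on fin that, of "\<lambda>i. inner (\<psi> i) f" "\<lambda>_. 1::real"]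
    by (simp add: p_def inner_sum_right inner_commute)
  then have "C (f - p) = c0 *\<^sub>R (f - p)"
    by (intro orth) (simp add: inner_diff_right)
  moreover have "C p = (\<Sum>i\<in>I. (inner (\<psi> i) f * c i) *\<^sub>R \<psi> i)"
    by (simp add: p_def linear_sum[OF lin] linear_cmul[OF lin] basis)
  ultimately have "C f = c0 *\<^sub>R (f - p) + (\<Sum>i\<in>I. (inner (\<psi> i) f * c i) *\<^sub>R \<psi> i)"
    by (metis diff_add_cancel lin linear_add)
  then show "C f = spectral_op c0 I c \<psi> f"
    by (simp add: spectral_op_def p_def left_diff_distrib scaleR_diff_left scaleR_diff_right
        sum_subtractf scaleR_sum_right mult.commute)
qed

lemma spectral_op_comp:
  assumes "orthonormal_on I \<psi>" "finite I"
  shows "spectral_op b0 I b \<psi> \<circ> spectral_op c0 I c \<psi> = spectral_op (b0 * c0) I (\<lambda>i. b i * c i) \<psi>"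
proof (rule linear_eq_spectral_op[OF _ assms])
  show "linear (spectral_op b0 I b \<psi> \<circ> spectral_op c0 I c \<psi>)"
    by (intro linear_compose linear_spectral_op)
qed (simp_all add: spectral_op_basis[OF assms] spectral_op_orthogonal
      linear_cmul[OF linear_spectral_op] mult.commute)

text \<open>The operator is the square of a symmetric one, so its quadratic form is a squared
  norm.\<close>

lemma spectral_op_nonneg:
  assumes on: "orthonormal_on I \<psi>" "finite I" and "c0 \<ge> 0" "\<And>i. i \<in> I \<Longrightarrow> c i \<ge> 0"
  shows "inner f (spectral_op c0 I c \<psi> f) \<ge> 0"
proof -
  let ?q = "spectral_op (sqrt c0) I (\<lambda>i. sqrt (c i)) \<psi>"
  have "spectral_op c0 I c \<psi> = ?q \<circ> ?q"
    \<comment> \<open>The definition is unfolded because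
      \<open>sqrt (c i) * sqrt (c i) = c i\<close> is known only for \<open>i \<in> I\<close>: the
      coefficient functions agree under the sum, not everywhere.\<close>
    using assms by (auto simp: spectral_op_comp[OF on] spectral_op_def fun_eq_iff)
  then have "inner f (spectral_op c0 I c \<psi> f) = inner (?q f) (?q f)"
    by (simp add: spectral_op_sym)
  then show ?thesis by simp
qed

text \<open>Any positive root is forced on each \<open>\<psi> j\<close> and on the complement by
  \<open>psd_root_eigenvector\<close>; this justifies the \<open>THE\<close> in
  \<open>op_sqrt\<close>.\<close>

lemma op_sqrt_spectral_op:
  assumes on: "orthonormal_on I \<psi>" "finite I" and c0: "c0 \<ge> 0" and c: "\<And>i. i \<in> I \<Longrightarrow> c i \<ge> 0"
  shows "op_sqrt (spectral_op c0 I c \<psi>) = spectral_op (sqrt c0) I (\<lambda>i. sqrt (c i)) \<psi>"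
  unfolding op_sqrt_def
proof (rule the_equality, intro conjI allI)
  let ?q = "spectral_op (sqrt c0) I (\<lambda>i. sqrt (c i)) \<psi>"
  show "bounded_linear ?q" by (rule bounded_linear_spectral_op)
  show "inner (?q x) y = inner x (?q y)" for x y by (rule spectral_op_sym)
  show "inner x (?q x) \<ge> 0" for x using assms by (intro spectral_op_nonneg) auto
  show "?q \<circ> ?q = spectral_op c0 I c \<psi>"
    using assms by (auto simp: spectral_op_comp[OF on] spectral_op_def fun_eq_iff)
next
  fix C
  assume C: "bounded_linear C \<and> (\<forall>x y. inner (C x) y = inner x (C y)) \<and>
    (\<forall>x. inner x (C x) \<ge> 0) \<and> C \<circ> C = spectral_op c0 I c \<psi>"
  then have lin: "linear C" by (simp add: bounded_linear.linear)
  have CC: "C (C f) = spectral_op c0 I c \<psi> f" for f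
    using C by (metis comp_apply)
  show "C = spectral_op (sqrt c0) I (\<lambda>i. sqrt (c i)) \<psi>"
  proof (rule linear_eq_spectral_op[OF lin on])
    show "C (\<psi> j) = sqrt (c j) *\<^sub>R \<psi> j" if "j \<in> I" for j
      using C c that by (intro psd_root_eigenvector lin) (auto simp: CC spectral_op_basis[OF on])
    show "C f = sqrt c0 *\<^sub>R f" if "\<And>i. i \<in> I \<Longrightarrow> inner (\<psi> i) f = 0" for f
      using C c0 that by (intro psd_root_eigenvector lin) (auto simp: CC spectral_op_orthogonal)
  qed
qed

text \<open>Removes the square root from the statistic: one self-adjoint factor moves across the
  inner product.\<close>

lemma inner_op_sqrt_spectral_op:
  assumes "orthonormal_on I \<psi>" "finite I" "c0 \<ge> 0" "\<And>i. i \<in> I \<Longrightarrow> c i \<ge> 0"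
  defines "A \<equiv> spectral_op c0 I c \<psi>"
  shows "inner (op_sqrt A u) (op_sqrt A v) = inner u (A v)"
proof -
  let ?q = "spectral_op (sqrt c0) I (\<lambda>i. sqrt (c i)) \<psi>"
  have "?q \<circ> ?q = A"
    using assms by (auto simp: spectral_op_comp spectral_op_def fun_eq_iff)
  then have "A v = ?q (?q v)" by (metis comp_apply)
  then show ?thesis
    using assms by (simp add: op_sqrt_spectral_op spectral_op_sym)
qed

text \<open>The functional calculus acts on an eigenspace of \<open>B\<close> by a scalar, whatever spectral
  representation is chosen; two finite representations of \<open>B\<close> therefore give the same operator.\<close>

lemma spectral_op_eigenvector:
  assumes on: "orthonormal_on I \<psi>" and fin: "finite I" and pos: "\<And>i. i \<in> I \<Longrightarrow> \<tau> i > 0"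
    and eig: "spectral_op 0 I \<tau> \<psi> f = t *\<^sub>R f"
  shows "spectral_op (\<phi> 0) I (\<lambda>i. \<phi> (\<tau> i)) \<psi> f = \<phi> t *\<^sub>R f"
proof -
  \<comment> \<open>Computing \<open>inner (B (\<psi> i)) f\<close> in two ways, with
    \<open>B\<close> the operator in \<open>eig\<close>, shows that \<open>f\<close> has components
    only along those \<open>\<psi> i\<close> with \<open>\<tau> i = t\<close>.\<close>
  have *: "\<tau> i * inner (\<psi> i) f = t * inner (\<psi> i) f" if "i \<in> I" for i
  proof -
    have "inner (spectral_op 0 I \<tau> \<psi> (\<psi> i)) f = inner (\<psi> i) (t *\<^sub>R f)"
      by (simp only: spectral_op_sym eig)
    then show ?thesis by (simp add: spectral_op_basis[OF on fin that])
  qed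
  show ?thesis
  proof (cases "t = 0")
    \<comment> \<open>Since all \<open>\<tau> i\<close> are positive, the kernel of the operator is
      exactly the complement of the \<open>\<psi> i\<close>, where the calculus acts by
      \<open>\<phi> 0\<close>.\<close>
    case True
    then have "inner (\<psi> i) f = 0" if "i \<in> I" for i
      using *[OF that] pos[OF that] by simp
    then show ?thesis
      using True by (simp add: spectral_op_orthogonal)
  next
    \<comment> \<open>For \<open>t \<noteq> 0\<close> the vector \<open>f\<close> lies in the range,
      hence in the span of the \<open>\<psi> i\<close>, and the \<open>\<phi> 0\<close>
      contributions cancel.\<close>
    case False
    have "t *\<^sub>R f = (\<Sum>i\<in>I. (\<tau> i * inner (\<psi> i) f) *\<^sub>R \<psi> i)"
      using eig by (simp add: spectral_op_def)
    also have "\<dots> = t *\<^sub>R (\<Sum>i\<in>I. inner (\<psi> i) f *\<^sub>R \<psi> i)"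
      by (simp add: scaleR_sum_right *)
    finally have f: "f = (\<Sum>i\<in>I. inner (\<psi> i) f *\<^sub>R \<psi> i)"
      using False by simp
    have "(\<Sum>i\<in>I. ((\<phi> (\<tau> i) - \<phi> 0) * inner (\<psi> i) f) *\<^sub>R \<psi> i) =
        (\<phi> t - \<phi> 0) *\<^sub>R (\<Sum>i\<in>I. inner (\<psi> i) f *\<^sub>R \<psi> i)"
      unfolding scaleR_sum_right using * by (intro sum.cong) auto
    then show ?thesis
      by (simp add: spectral_op_def f[symmetric] algebra_simps)
  qed
qed

lemma spectral_op_calculus_cong:
  assumes I: "orthonormal_on I \<psi>" "finite I" and \<tau>: "\<And>i. i \<in> I \<Longrightarrow> \<tau> i > 0"
    and J: "orthonormal_on J \<xi>" "finite J"
    and eq: "spectral_op 0 I \<tau> \<psi> = spectral_op 0 J \<sigma> \<xi>"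
  shows "spectral_op (\<phi> 0) I (\<lambda>i. \<phi> (\<tau> i)) \<psi> = spectral_op (\<phi> 0) J (\<lambda>i. \<phi> (\<sigma> i)) \<xi>"
proof (rule linear_eq_spectral_op[OF linear_spectral_op J])
  show "spectral_op (\<phi> 0) I (\<lambda>i. \<phi> (\<tau> i)) \<psi> (\<xi> j) = \<phi> (\<sigma> j) *\<^sub>R \<xi> j" if "j \<in> J" for j
    by (rule spectral_op_eigenvector[OF I \<tau>]) (simp_all add: eq spectral_op_basis[OF J that])
  show "spectral_op (\<phi> 0) I (\<lambda>i. \<phi> (\<tau> i)) \<psi> f = \<phi> 0 *\<^sub>R f"
    if "\<And>i. i \<in> J \<Longrightarrow> inner (\<xi> i) f = 0" for f
    by (rule spectral_op_eigenvector[OF I \<tau>]) (simp_all add: eq spectral_op_orthogonal that)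
qed

section \<open>Spectral representations and evaluation of \<open>op_fun\<close>\<close>

lemma spectral_rep_spectral_op:
  assumes J: "orthonormal_on J \<xi>" "finite J" and \<sigma>: "\<And>j. j \<in> J \<Longrightarrow> \<sigma> j > 0"
  shows "\<exists>I \<tau> \<psi>. spectral_rep (spectral_op 0 J \<sigma> \<xi>) I \<tau> \<psi>"
proof -
  \<comment> \<open>\<open>spectral_rep\<close> is indexed by naturals while \<open>J\<close> has an
    arbitrary index type, so \<open>J\<close> is enumerated.\<close>
  obtain h where h: "bij_betw h {0..<card J} J"
    using ex_bij_betw_nat_finite[OF J(2)] by blast
  have "spectral_rep (spectral_op 0 J \<sigma> \<xi>) {0..<card J} (\<sigma> \<circ> h) (\<xi> \<circ> h)"
    unfolding spectral_rep_def
  proof (intro conjI ballI allI)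
    fix i j assume "i \<in> {0..<card J}" "j \<in> {0..<card J}"
    then show "inner ((\<xi> \<circ> h) i) ((\<xi> \<circ> h) j) = (if i = j then 1 else 0)"
      using J(1) bij_betwE[OF h] inj_on_eq_iff[OF bij_betw_imp_inj_on[OF h]]
      by (simp add: orthonormal_on_def)
  next
    fix i assume "i \<in> {0..<card J}"
    then show "(\<sigma> \<circ> h) i > 0"
      using \<sigma> bij_betwE[OF h] by simp
  next
    fix f
    have "spectral_op 0 J \<sigma> \<xi> f =
        (\<Sum>i\<in>{0..<card J}. (\<sigma> \<circ> h) i *\<^sub>R tensor_op ((\<xi> \<circ> h) i) ((\<xi> \<circ> h) i) f)"
      unfolding spectral_op_def by (subst sum.reindex_bij_betw[OF h, symmetric])
        (simp add: tensor_op_def)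
    then show "((\<lambda>i. (\<sigma> \<circ> h) i *\<^sub>R tensor_op ((\<xi> \<circ> h) i) ((\<xi> \<circ> h) i) f) has_sum
        spectral_op 0 J \<sigma> \<xi> f) {0..<card J}"
      by (simp add: has_sum_finite_iff)
  qed
  then show ?thesis by blast
qed

text \<open>A representation may a priori be infinite. But each \<open>\<psi> j\<close> is an
  eigenvector with nonzero eigenvalue, hence lies in the range, inside the span of finitely many
  \<open>\<xi>\<close>; orthonormal vectors are independent, so there are finitely many.\<close>

lemma spectral_rep_finite:
  assumes J: "finite J" and rep: "spectral_rep (spectral_op 0 J \<sigma> \<xi>) I \<tau> \<psi>"
  shows "finite I"
proof -
  let ?B = "spectral_op 0 J \<sigma> \<xi>"
  have pos: "\<tau> i > 0" if "i \<in> I" for i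
    using rep that by (simp add: spectral_rep_def)
  have on: "inner (\<psi> i) (\<psi> j) = (if i = j then 1 else 0)" if "i \<in> I" "j \<in> I" for i j
    using rep that by (simp add: spectral_rep_def)
  have inj: "inj_on \<psi> I"
    using on by (metis inj_onI zero_neq_one)
  have sp: "\<psi> j \<in> span (\<xi> ` J)" if j: "j \<in> I" for j
  proof -
    have "((\<lambda>i. \<tau> i *\<^sub>R tensor_op (\<psi> i) (\<psi> i) (\<psi> j)) has_sum ?B (\<psi> j)) I"
      using rep by (simp add: spectral_rep_def)
    moreover have "((\<lambda>i. \<tau> i *\<^sub>R tensor_op (\<psi> i) (\<psi> i) (\<psi> j)) has_sum \<tau> j *\<^sub>R \<psi> j) I"
      \<comment> \<open>Orthonormality leaves only the term at \<open>j\<close>; uniqueness of the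
        sum then makes \<open>\<psi> j\<close> an eigenvector.\<close>
      using j on by (intro has_sum_finite_neutralI[where B="{j}"]) (auto simp: tensor_op_def)
    ultimately have "?B (\<psi> j) = \<tau> j *\<^sub>R \<psi> j"
      by (rule has_sum_unique)
    moreover have "?B (\<psi> j) \<in> span (\<xi> ` J)"
      by (simp add: spectral_op_def span_sum span_scale span_base)
    ultimately have "(1 / \<tau> j) *\<^sub>R (\<tau> j *\<^sub>R \<psi> j) \<in> span (\<xi> ` J)"
      by (metis span_scale)
    then show ?thesis using pos[OF j] by simp
  qed
  have "independent (\<psi> ` I)"
  proof (rule pairwise_orthogonal_independent)
    show "pairwise orthogonal (\<psi> ` I)"
      using on by (auto simp: pairwise_def orthogonal_def)
    show "0 \<notin> \<psi> ` I"
      using on by (metis imageE inner_zero_left zero_neq_one)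
  qed
  then have "finite (\<psi> ` I)"
    using independent_span_bound[of "\<xi> ` J" "\<psi> ` I"] J sp by blast
  then show ?thesis
    using inj by (simp add: finite_image_iff)
qed

text \<open>Whichever representation \<open>SOME\<close> picks exists, is finite and yields the same
  calculus as the given one, so \<open>op_fun\<close> can be computed from any known
  diagonalisation.\<close>

lemma op_fun_spectral_op:
  assumes J: "orthonormal_on J \<xi>" "finite J" and \<sigma>: "\<And>j. j \<in> J \<Longrightarrow> \<sigma> j > 0"
  shows "op_fun \<phi> (spectral_op 0 J \<sigma> \<xi>) = spectral_op (\<phi> 0) J (\<lambda>j. \<phi> (\<sigma> j)) \<xi>"
proof -
  let ?B = "spectral_op 0 J \<sigma> \<xi>"
  obtain I \<tau> \<psi> where some: "(SOME (I, \<tau>, \<psi>). spectral_rep ?B I \<tau> \<psi>) = (I, \<tau>, \<psi>)"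
    using prod_cases3 by blast
  have "\<exists>p. case p of (I, \<tau>, \<psi>) \<Rightarrow> spectral_rep ?B I \<tau> \<psi>"
    using spectral_rep_spectral_op[OF J \<sigma>] by auto
  then have rep: "spectral_rep ?B I \<tau> \<psi>"
    using some someI_ex[of "\<lambda>(I, \<tau>, \<psi>). spectral_rep ?B I \<tau> \<psi>"] by simp
  have fin: "finite I"
    using spectral_rep_finite[OF J(2) rep] .
  have on: "orthonormal_on I \<psi>" and pos: "\<And>i. i \<in> I \<Longrightarrow> \<tau> i > 0"
    using rep by (auto simp: spectral_rep_def orthonormal_on_def)
  have B: "spectral_op 0 I \<tau> \<psi> = ?B"
    using rep fin by (auto simp: spectral_rep_def spectral_op_def[of 0 I] has_sum_finite_iff
        tensor_op_def fun_eq_iff)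
  have "spectral_op (\<phi> 0) I (\<lambda>i. \<phi> (\<tau> i)) \<psi> = spectral_op (\<phi> 0) J (\<lambda>j. \<phi> (\<sigma> j)) \<xi>"
    using spectral_op_calculus_cong[OF on fin pos J B] .
  moreover have "op_fun \<phi> ?B = spectral_op (\<phi> 0) I (\<lambda>i. \<phi> (\<tau> i)) \<psi>"
    using fin by (simp add: op_fun_def some spectral_op_def[of "\<phi> 0" I] tensor_op_def fun_eq_iff
        left_diff_distrib scaleR_diff_left scaleR_diff_right sum_subtractf scaleR_sum_right)
  ultimately show ?thesis by simp
qed

section \<open>Matrices and off-diagonal sums\<close>

text \<open>For uniqueness, split \<open>v\<close> into \<open>P *v v\<close> and
  \<open>v - P *v v\<close>. These are eigenvectors of \<open>B ** B\<close> for \<open>c\<close>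
  and \<open>0\<close>, so \<open>psd_root_eigenvector\<close> fixes \<open>B\<close> on
  both.\<close>

lemma matrix_sqrt_scaled_projection:
  fixes P :: "real ^ 's ^ 's"
  assumes sym: "transpose P = P" and idem: "P ** P = P" and c: "c \<ge> 0"
  shows "matrix_sqrt (c *\<^sub>R P) = sqrt c *\<^sub>R P"
  unfolding matrix_sqrt_def
proof (rule the_equality, intro conjI allI)
  show "transpose (sqrt c *\<^sub>R P) = sqrt c *\<^sub>R P"
    by (simp add: transpose_scalar sym)
  show "sqrt c *\<^sub>R P ** (sqrt c *\<^sub>R P) = c *\<^sub>R P"
    using c by (simp add: scalar_matrix_assoc[symmetric] matrix_scalar_ac idem)
  fix v
  have "inner v (P *v v) = inner (P *v v) (P *v v)"
    by (metis dot_lmul_matrix idem matrix_vector_mul_assoc sym transpose_matrix_vector)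
  then show "inner v (sqrt c *\<^sub>R P *v v) \<ge> 0"
    using c by (simp add: scaleR_matrix_vector_assoc[symmetric])
next
  fix B :: "real ^ 's ^ 's"
  assume B: "transpose B = B \<and> (\<forall>v. inner v (B *v v) \<ge> 0) \<and> B ** B = c *\<^sub>R P"
  have BB: "B *v (B *v v) = c *\<^sub>R (P *v v)" for v
    using B by (simp add: matrix_vector_mul_assoc scaleR_matrix_vector_assoc)
  have PP: "P *v (P *v v) = P *v v" for v
    by (simp add: matrix_vector_mul_assoc idem)
  have sB: "inner (B *v x) y = inner x (B *v y)" for x y
    using B by (metis dot_lmul_matrix transpose_matrix_vector)
  have pB: "inner v (B *v v) \<ge> 0" for v
    using B by blast
  note root = psd_root_eigenvector[OF matrix_vector_mul_linear sB pB]
  have "B *v v = (sqrt c *\<^sub>R P) *v v" for v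
  proof -
    have "B *v (P *v v) = sqrt c *\<^sub>R (P *v v)"
      by (rule root) (simp_all add: BB PP c)
    moreover have "B *v (v - P *v v) = sqrt 0 *\<^sub>R (v - P *v v)"
      by (rule root) (simp_all add: BB PP matrix_vector_mult_diff_distrib)
    ultimately show ?thesis
      by (simp add: matrix_vector_mult_diff_distrib scaleR_matrix_vector_assoc)
  qed
  then show "B = sqrt c *\<^sub>R P"
    by (simp add: matrix_eq)
qed

lemma transpose_centering: "transpose centering = centering"
  by (simp add: vec_eq_iff transpose_def centering_def outer_def mat_def)

lemma centering_idem: "(centering :: real ^ 's ^ 's) ** centering = centering"
proof -
  have "(\<Sum>k\<in>UNIV. ((if i = k then 1 else 0) - 1 / real CARD('s)) *
      ((if k = j then 1 else 0) - 1 / real CARD('s))) = (if i = j then 1 else 0) - 1 / real CARD('s)"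
    for i j :: 's
    by (simp add: left_diff_distrib right_diff_distrib sum_subtractf if_distrib[of "\<lambda>x. x * _"]
        if_distrib[of "\<lambda>x. _ * x"] sum.delta sum.delta' sum_divide_distrib[symmetric] cong: if_cong)
  then show ?thesis
    by (simp add: vec_eq_iff matrix_matrix_mult_def centering_def outer_def mat_def)
qed

lemma transpose_matrix_sqrt_scaled_centering:
  "transpose (matrix_sqrt scaled_centering) = (matrix_sqrt scaled_centering :: real ^ 's ^ 's)"
  \<comment> \<open>The centering matrix is an orthogonal projection. Its factor is nonnegative for
    every cardinality; for one element it is \<open>1 / 0 = 0\<close>.\<close>
  by (simp add: scaled_centering_def matrix_sqrt_scaled_projection transpose_centering
      centering_idem transpose_scalar)

lemma matrix_sqrt_scaled_centering_square:
  "matrix_sqrt scaled_centering ** matrix_sqrt scaled_centering =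
    (scaled_centering :: real ^ 's ^ 's)"
  by (simp add: scaled_centering_def matrix_sqrt_scaled_projection transpose_centering
      centering_idem scalar_matrix_assoc[symmetric] matrix_scalar_ac)

section \<open>Outer products and orthonormal bases\<close>

lemma outer_matrix_mult: "A ** outer u v ** transpose B = outer (A *v u) (B *v v)"
  by (simp add: vec_eq_iff matrix_matrix_mult_def matrix_vector_mult_def outer_def transpose_def
      sum_distrib_left sum_distrib_right mult_ac)
    (intro allI, rule sum.swap)

lemma matrix_add_rdistrib: "(A + B) ** C = A ** C + B ** C"
  by (simp add: vec_eq_iff matrix_matrix_mult_def distrib_right sum.distrib)

lemma matrix_mult_sum_outer:
  fixes A :: "real ^ 'a ^ 'p" and B :: "real ^ 'b ^ 'q"
  assumes "finite I"
  shows "A ** (\<Sum>i\<in>I. c i *\<^sub>R outer (u i) (v i)) ** transpose B =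
    (\<Sum>i\<in>I. c i *\<^sub>R outer (A *v u i) (B *v v i))"
  using assms
  by induction (simp_all add: matrix_add_ldistrib matrix_add_rdistrib outer_matrix_mult
      scalar_matrix_assoc[symmetric] matrix_scalar_ac)

text \<open>The square matrix with rows \<open>e i\<close> has its transpose as right inverse, hence
  also as left inverse, so it preserves inner products.\<close>

lemma orthonormal_parseval:
  fixes e :: "'s::finite \<Rightarrow> real ^ 's"
  assumes "\<And>i j. inner (e i) (e j) = (if i = j then 1 else 0)"
  shows "(\<Sum>i\<in>UNIV. inner (e i) v * inner (e i) w) = inner v w"
proof -
  define P :: "real ^ 's ^ 's" where "P = (\<chi> i. e i)"
  have "P ** transpose P = mat 1"
    using assms
    by (simp add: vec_eq_iff P_def matrix_matrix_mult_def transpose_def mat_def inner_vec_def)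
  then have PP: "transpose P ** P = mat 1"
    by (simp add: matrix_left_right_inverse)
  have Pv: "(P *v x) $ i = inner (e i) x" for x i
    by (simp add: P_def matrix_vector_mult_def inner_vec_def)
  have "inner (P *v v) (P *v w) = inner v w"
    by (metis PP dot_lmul_matrix matrix_vector_mul_assoc matrix_vector_mul_lid
        transpose_matrix_vector transpose_transpose)
  then show ?thesis
    by (simp add: inner_vec_def[of "P *v v"] Pv)
qed

section \<open>Bilinear forms summed over off-diagonal pairs\<close>

lemma sum_offdiag:
  fixes f :: "'a::finite \<Rightarrow> 'a \<Rightarrow> 'b::ab_group_add"
  shows "(\<Sum>(i, j)\<in>{(i, j). i \<noteq> j}. f i j) = (\<Sum>i\<in>UNIV. \<Sum>j\<in>UNIV. f i j) - (\<Sum>i\<in>UNIV. f i i)"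
proof -
  have "(\<Sum>i\<in>UNIV. \<Sum>j\<in>UNIV. f i j) = (\<Sum>(i, j)\<in>{(i, j). i \<noteq> j} \<union> {(i, j). i = j}. f i j)"
    by (simp add: sum.cartesian_product) (rule sum.cong, auto)
  also have "\<dots> = (\<Sum>(i, j)\<in>{(i, j). i \<noteq> j}. f i j) + (\<Sum>(i, j)\<in>{(i, j). i = j}. f i j)"
    by (rule sum.union_disjoint) auto
  also have "(\<Sum>(i, j)\<in>{(i, j). i = j}. f i j) = (\<Sum>i\<in>UNIV. f i i)"
    by (rule sum.reindex_bij_witness[of _ "\<lambda>i. (i, i)" fst]) auto
  finally show ?thesis by simp
qed

lemma sum_offdiag_form:
  fixes x :: "'n::finite \<Rightarrow> 'h::real_inner" and y :: "'m::finite \<Rightarrow> 'h"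
  assumes lin: "linear A" and sym: "\<And>u v. inner (A u) v = inner u (A v)"
    and card: "CARD('n) \<ge> 2" "CARD('m) \<ge> 2"
  shows "1 / (real CARD('n) * (real CARD('n) - 1)) * (1 / (real CARD('m) * (real CARD('m) - 1))) *
      (\<Sum>(i, j)\<in>{(i, j). i \<noteq> j}. \<Sum>(i', j')\<in>{(i', j'). i' \<noteq> j'}.
        inner (x i - y i') (A (x j - y j'))) =
    1 / (real CARD('n) * (real CARD('n) - 1)) *
      ((\<Sum>i\<in>UNIV. \<Sum>j\<in>UNIV. inner (x i) (A (x j))) - (\<Sum>i\<in>UNIV. inner (x i) (A (x i)))) +
    1 / (real CARD('m) * (real CARD('m) - 1)) *
      ((\<Sum>i\<in>UNIV. \<Sum>j\<in>UNIV. inner (y i) (A (y j))) - (\<Sum>i\<in>UNIV. inner (y i) (A (y i)))) -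
    2 / (real CARD('n) * real CARD('m)) * (\<Sum>i\<in>UNIV. \<Sum>j\<in>UNIV. inner (y i) (A (x j)))"
    (is "?l = 1 / _ * (?xx - ?x) + 1 / _ * (?yy - ?y) - _ * ?yx")
proof -
  let ?n = "real CARD('n)" and ?m = "real CARD('m)"
  have yx: "(\<Sum>j\<in>UNIV. \<Sum>i\<in>UNIV. inner (y i) (A (x j))) = ?yx"
    by (rule sum.swap)
  have xy: "inner (x i) (A (y j)) = inner (y j) (A (x i))" for i j
    by (metis inner_commute sym)
  \<comment> \<open>Each \<open>k\<close> occurs \<open>m - 1\<close> times as first and as second
    entry of an off-diagonal pair, and there are \<open>m * (m - 1)\<close> such pairs.\<close>
  have inner_sum: "(\<Sum>(i', j')\<in>{(i', j'). i' \<noteq> j'}. inner (x i - y i') (A (x j - y j'))) =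
      ?m * (?m - 1) * inner (x i) (A (x j)) - (?m - 1) * (\<Sum>k\<in>UNIV. inner (y k) (A (x i)))
      - (?m - 1) * (\<Sum>k\<in>UNIV. inner (y k) (A (x j))) + (?yy - ?y)" for i j
    by (simp add: sum_offdiag linear_diff[OF lin] inner_diff_left inner_diff_right sum.distrib
        sum_subtractf xy left_diff_distrib right_diff_distrib sum_distrib_left[symmetric])
  \<comment> \<open>The same count over \<open>(i, j)\<close> gives \<open>n - 1\<close>; the two
    mixed terms agree by symmetry of \<open>A\<close>, whence the factor 2.\<close>
  have total: "(\<Sum>(i, j)\<in>{(i, j). i \<noteq> j}. \<Sum>(i', j')\<in>{(i', j'). i' \<noteq> j'}.
        inner (x i - y i') (A (x j - y j'))) =
      ?m * (?m - 1) * (?xx - ?x) - 2 * (?n - 1) * (?m - 1) * ?yx + ?n * (?n - 1) * (?yy - ?y)"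
    unfolding inner_sum sum_offdiag
    by (simp add: sum.distrib sum_subtractf sum_distrib_left[symmetric] yx algebra_simps)
  \<comment> \<open>Here \<open>p\<close> and \<open>q\<close> stand for \<open>n - 1\<close> and
    \<open>m - 1\<close>, nonzero because both cardinalities are at least 2.\<close>
  have alg: "1 / (n * p) * (1 / (m * q)) * (m * q * a - 2 * p * q * b + n * p * c) =
      1 / (n * p) * a + 1 / (m * q) * c - 2 / (n * m) * b"
    if "n \<noteq> 0" "p \<noteq> 0" "m \<noteq> 0" "q \<noteq> 0" for n m p q a b c :: real
    using that by (simp add: field_simps)
  show ?thesis
    unfolding total by (rule alg) (use card in simp_all)
qed

section \<open>The empirical covariance operator\<close>

text \<open>\<open>rkhs\<close> provides a representer of evaluation at \<open>x\<close>;
  injectivity of \<open>ev\<close> identifies it with the \<open>THE\<close> in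
  \<open>kernel_section\<close>.\<close>

lemma kernel_section_reproducing:
  assumes "rkhs ev K"
  shows "inner f (kernel_section ev K x) = ev f x"
    and "ev (kernel_section ev K x) = (\<lambda>y. K y x)"
proof -
  obtain k where k: "ev k = (\<lambda>y. K y x)" "\<And>f. inner f k = ev f x"
    using assms unfolding rkhs_def by blast
  have "kernel_section ev K x = k"
    unfolding kernel_section_def using assms k(1) by (auto simp: rkhs_def inj_def)
  with k show "inner f (kernel_section ev K x) = ev f x"
    and "ev (kernel_section ev K x) = (\<lambda>y. K y x)" by simp_all
qed

lemma inner_kernel_section:
  assumes "rkhs ev K"
  shows "inner (kernel_section ev K x) (kernel_section ev K y) = K x y"
  using kernel_section_reproducing[OF assms] by (metis inner_commute)

text \<open>The synthesis operator, adjoint to the sampling map that sends \<open>f\<close> to the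
  vector of the \<open>inner (k a) f\<close>.\<close>

definition kernel_comb :: "('s::finite \<Rightarrow> 'h::real_inner) \<Rightarrow> real ^ 's \<Rightarrow> 'h" where
  "kernel_comb k w = (\<Sum>a\<in>UNIV. w $ a *\<^sub>R k a)"

lemma inner_kernel_comb: "inner (kernel_comb k w) f = (\<Sum>a\<in>UNIV. w $ a * inner (k a) f)"
  by (simp add: kernel_comb_def inner_sum_left)

lemma inner_kernel_comb_comb:
  assumes "\<And>a b. M $ a $ b = inner (k a) (k b)"
  shows "inner (kernel_comb k v) (kernel_comb k w) = inner v (M *v w)"
  by (simp add: inner_kernel_comb inner_vec_def matrix_vector_mult_def assms)
    (simp add: kernel_comb_def inner_sum_right mult.commute)

text \<open>Summing the outer squares of \<open>R *v e i\<close> over an orthonormal basis gives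
  \<open>R ** transpose R\<close>, whatever the basis.\<close>

lemma sum_tensor_kernel_comb:
  fixes e :: "'s::finite \<Rightarrow> real ^ 's" and R :: "real ^ 's ^ 's"
  assumes on: "\<And>i j. inner (e i) (e j) = (if i = j then 1 else 0)"
  shows "(\<Sum>i\<in>UNIV. inner (kernel_comb k (R *v e i)) f *\<^sub>R kernel_comb k (R *v e i)) =
    (\<Sum>a\<in>UNIV. \<Sum>b\<in>UNIV. ((R ** transpose R) $ a $ b * inner (k b) f) *\<^sub>R k a)"
proof -
  \<comment> \<open>The entries of \<open>R *v e i\<close> are the coordinates of the rows of
    \<open>R\<close> in the basis \<open>e\<close>, so this is Parseval for two rows.\<close>
  have RR: "(R ** transpose R) $ a $ b = (\<Sum>i\<in>UNIV. (R *v e i) $ a * (R *v e i) $ b)" for a b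
    using orthonormal_parseval[OF on, of "R $ a" "R $ b"]
    by (simp add: matrix_matrix_mult_def transpose_def inner_vec_def matrix_vector_mult_def
        mult.commute)
  have "(\<Sum>i\<in>UNIV. inner (kernel_comb k (R *v e i)) f *\<^sub>R kernel_comb k (R *v e i)) =
    (\<Sum>i\<in>UNIV. \<Sum>a\<in>UNIV. \<Sum>b\<in>UNIV. ((R *v e i) $ a * (R *v e i) $ b * inner (k b) f) *\<^sub>R k a)"
    unfolding inner_kernel_comb
    by (simp add: kernel_comb_def scaleR_sum_right scaleR_sum_left[symmetric]
        sum_distrib_right sum_distrib_left mult_ac)
  also have "\<dots> = (\<Sum>a\<in>UNIV. \<Sum>b\<in>UNIV. \<Sum>i\<in>UNIV.
      ((R *v e i) $ a * (R *v e i) $ b * inner (k b) f) *\<^sub>R k a)"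
    by (subst sum.swap, rule sum.cong[OF refl], rule sum.swap)
  also have "\<dots> = (\<Sum>a\<in>UNIV. \<Sum>b\<in>UNIV. ((R ** transpose R) $ a $ b * inner (k b) f) *\<^sub>R k a)"
    by (simp add: RR scaleR_sum_left[symmetric] sum_distrib_right)
  finally show ?thesis .
qed

text \<open>Both the sum over pairwise differences and the centered double sum are multiples of
  \<open>p - (1 / s) *\<^sub>R q *\<^sub>R t\<close>, the sum of tensor squares minus its mean
  part.\<close>

lemma emp_cov_centering:
  fixes Y :: "'s::finite \<Rightarrow> 'x" and ev :: "'h::real_inner \<Rightarrow> 'x \<Rightarrow> real"
    and K :: "'x \<Rightarrow> 'x \<Rightarrow> real"
  defines "k \<equiv> \<lambda>a. kernel_section ev K (Y a)"
  assumes card: "CARD('s) \<ge> 2"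
  shows "emp_cov ev K Y f = (1 / real CARD('s)) *\<^sub>R
    (\<Sum>a\<in>UNIV. \<Sum>b\<in>UNIV. (scaled_centering $ a $ b * inner (k b) f) *\<^sub>R k a)"
proof -
  let ?s = "real CARD('s)"
  define p where "p = (\<Sum>a\<in>UNIV. inner (k a) f *\<^sub>R k a)"
  define q where "q = (\<Sum>a\<in>UNIV. inner (k a) f)"
  define t where "t = (\<Sum>a\<in>UNIV. k a)"
  have cov: "(\<Sum>(i, j)\<in>{(i, j). i \<noteq> j}. tensor_op (k i - k j) (k i - k j) f) =
      (2 * ?s) *\<^sub>R (p - (1 / ?s) *\<^sub>R q *\<^sub>R t)"
  proof -
    \<comment> \<open>Diagonal differences vanish, so the sum may run over all pairs.\<close>
    have "(\<Sum>(i, j)\<in>{(i, j). i \<noteq> j}. tensor_op (k i - k j) (k i - k j) f) =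
      (\<Sum>i\<in>UNIV. \<Sum>j\<in>UNIV. inner (k i) f *\<^sub>R k i - inner (k j) f *\<^sub>R k i - inner (k i) f *\<^sub>R k j
        + inner (k j) f *\<^sub>R k j)"
      by (simp add: sum_offdiag tensor_op_def inner_diff_left scaleR_diff_left scaleR_diff_right
          algebra_simps)
    also have "\<dots> = ?s *\<^sub>R p - q *\<^sub>R t - q *\<^sub>R t + ?s *\<^sub>R p"
      by (simp add: sum.distrib sum_subtractf p_def q_def t_def scaleR_sum_right[symmetric]
          scaleR_sum_left[symmetric] sum_constant_scaleR)
        (simp add: scaleR_sum_right mult.commute)
    finally have "(\<Sum>(i, j)\<in>{(i, j). i \<noteq> j}. tensor_op (k i - k j) (k i - k j) f) =
        ?s *\<^sub>R p - q *\<^sub>R t - q *\<^sub>R t + ?s *\<^sub>R p" .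
    moreover have "(2 * r) *\<^sub>R v = r *\<^sub>R v + r *\<^sub>R v" for r and v :: 'h
      by (metis mult_2 scaleR_left_distrib)
    ultimately show ?thesis
      by (simp add: scaleR_diff_right)
  qed
  have cen: "(\<Sum>a\<in>UNIV. \<Sum>b\<in>UNIV. (scaled_centering $ a $ b * inner (k b) f) *\<^sub>R k a) =
      (?s / (?s - 1)) *\<^sub>R (p - (1 / ?s) *\<^sub>R q *\<^sub>R t)"
  proof -
    have "(\<Sum>b\<in>UNIV. scaled_centering $ a $ b * inner (k b) f) =
        ?s / (?s - 1) * (inner (k a) f - 1 / ?s * q)" for a
    proof -
      have "(\<Sum>b\<in>UNIV. scaled_centering $ a $ b * inner (k b) f) =
          (\<Sum>b\<in>UNIV. ?s / (?s - 1) * ((if a = b then inner (k b) f else 0) - 1 / ?s * inner (k b) f))"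
        by (intro sum.cong refl)
          (simp add: scaled_centering_def centering_def outer_def mat_def algebra_simps)
      also have "\<dots> = ?s / (?s - 1) * (inner (k a) f - 1 / ?s * q)"
        by (simp only: sum_distrib_left[symmetric] sum_subtractf q_def) simp
      finally show ?thesis .
    qed
    then show ?thesis
      by (simp only: scaleR_sum_left[symmetric])
        (simp add: p_def t_def scaleR_sum_right sum_subtractf scaleR_diff_left scaleR_diff_right
          right_diff_distrib)
  qed
  have "1 / (2 * ?s * (?s - 1)) * (2 * ?s) = 1 / ?s * (?s / (?s - 1))"
    using card by simp
  then show ?thesis
    unfolding emp_cov_def cen cov[unfolded k_def]
    by (simp only: scaleR_scaleR)
qed

text \<open>The Gram matrix of the \<open>u i\<close> is that of the form given by
  \<open>R ** gram K Y Y ** R\<close> in its own eigenbasis, hence diagonal with entries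
  \<open>s * lam i\<close>. Nonnegativity, orthonormality after scaling and the diagonalisation all
  follow.\<close>

lemma emp_cov_spectral_op:
  fixes Y :: "'s::finite \<Rightarrow> 'x" and ev :: "'h::{real_inner,complete_space} \<Rightarrow> 'x \<Rightarrow> real"
    and K :: "'x \<Rightarrow> 'x \<Rightarrow> real" and e :: "'s \<Rightarrow> real ^ 's" and lam :: "'s \<Rightarrow> real"
  defines "R \<equiv> matrix_sqrt scaled_centering :: real ^ 's ^ 's"
  defines "u \<equiv> \<lambda>i. kernel_comb (\<lambda>a. kernel_section ev K (Y a)) (R *v e i)"
  defines "\<psi> \<equiv> \<lambda>i. (1 / sqrt (real CARD('s) * lam i)) *\<^sub>R u i"
  assumes rkhs: "rkhs ev K" and card: "CARD('s) \<ge> 2"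
    and eig: "eigensystem ((1 / real CARD('s)) *\<^sub>R (R ** gram K Y Y ** R)) lam e"
  shows "lam i \<ge> 0"
    and "orthonormal_on {i. lam i \<noteq> 0} \<psi>"
    and "emp_cov ev K Y = spectral_op 0 {i. lam i \<noteq> 0} lam \<psi>"
proof -
  let ?s = "real CARD('s)"
  have R: "transpose R = R" "R ** R = scaled_centering"
    by (simp_all add: R_def transpose_matrix_sqrt_scaled_centering
        matrix_sqrt_scaled_centering_square)
  have on: "\<And>i j. inner (e i) (e j) = (if i = j then 1 else 0)"
    and eigv: "\<And>i. ((1 / ?s) *\<^sub>R (R ** gram K Y Y ** R)) *v e i = lam i *\<^sub>R e i"
    using eig by (simp_all add: eigensystem_def)
  have ortho: "inner (u i) (u j) = (if i = j then ?s * lam i else 0)" for i j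
  proof -
    have "inner (u i) (u j) = inner (R *v e i) (gram K Y Y *v (R *v e j))"
      unfolding u_def
      by (rule inner_kernel_comb_comb) (simp add: gram_def inner_kernel_section[OF rkhs])
    also have "\<dots> = inner (e i) ((R ** gram K Y Y ** R) *v e j)"
      by (metis R(1) dot_lmul_matrix matrix_vector_mul_assoc transpose_matrix_vector)
    also have "(R ** gram K Y Y ** R) *v e j = ?s *\<^sub>R ((1 / ?s) *\<^sub>R (R ** gram K Y Y ** R) *v e j)"
      using card by (simp add: scaleR_matrix_vector_assoc)
    also have "\<dots> = (?s * lam j) *\<^sub>R e j"
      by (simp add: eigv)
    finally show ?thesis by (simp add: on)
  qed
  have lam: "lam i \<ge> 0" for i
  proof -
    have "?s * lam i \<ge> 0" by (metis ortho inner_ge_zero)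
    then show ?thesis using card by (simp add: zero_le_mult_iff)
  qed
  show "lam i \<ge> 0" by (rule lam)
  show "orthonormal_on {i. lam i \<noteq> 0} \<psi>"
    using lam card by (auto simp: orthonormal_on_def \<psi>_def ortho real_sqrt_mult_self
        abs_of_nonneg simp flip: real_sqrt_mult)
  show "emp_cov ev K Y = spectral_op 0 {i. lam i \<noteq> 0} lam \<psi>"
  proof
    fix f
    have "emp_cov ev K Y f = (1 / ?s) *\<^sub>R (\<Sum>i\<in>UNIV. inner (u i) f *\<^sub>R u i)"
      by (simp add: emp_cov_centering[OF card] u_def sum_tensor_kernel_comb[OF on] R)
    also have "\<dots> = (\<Sum>i\<in>UNIV. (1 / ?s * inner (u i) f) *\<^sub>R u i)"
      by (simp add: scaleR_sum_right)
    also have "\<dots> = (\<Sum>i\<in>{i. lam i \<noteq> 0}. (1 / ?s * inner (u i) f) *\<^sub>R u i)"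
    \<comment> \<open>For \<open>lam i = 0\<close> the vector \<open>u i\<close> has norm zero, so
      its term drops out.\<close>
    proof (rule sum.mono_neutral_right)
      have "u i = 0" if "lam i = 0" for i
        using ortho[of i i] that by simp
      then show "\<forall>i\<in>UNIV - {i. lam i \<noteq> 0}. (1 / ?s * inner (u i) f) *\<^sub>R u i = 0"
        by simp
    qed auto
    also have "\<dots> = spectral_op 0 {i. lam i \<noteq> 0} lam \<psi> f"
      \<comment> \<open>The factor \<open>lam i\<close> cancels against the squared normalisation
        \<open>1 / (s * lam i)\<close>, leaving \<open>1 / s\<close>.\<close>
      unfolding spectral_op_def \<psi>_def using lam card
      by (auto intro!: sum.cong simp: field_simps simp flip: real_sqrt_mult)
    finally show "emp_cov ev K Y f = spectral_op 0 {i. lam i \<noteq> 0} lam \<psi> f" .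
  qed
qed

section \<open>Evaluation of the two-sample statistic\<close>

lemma inner_one_matrix_one: "inner 1 (M *v 1) = (\<Sum>i\<in>UNIV. \<Sum>j\<in>UNIV. M $ i $ j)"
  for M :: "real ^ 'b ^ 'a"
  by (simp add: inner_vec_def matrix_vector_mult_def)

theorem theorem7:
  fixes ev :: "'h::{real_inner,complete_space} \<Rightarrow> 'x::second_countable_topology \<Rightarrow> real"
    and K :: "'x \<Rightarrow> 'x \<Rightarrow> real"
    and g :: "real \<Rightarrow> real \<Rightarrow> real"
    and l :: real
    and X :: "'n::finite \<Rightarrow> 'x"
    and X0 :: "'m::finite \<Rightarrow> 'x"
    and Y0 :: "'s::finite \<Rightarrow> 'x"
    and lam :: "'s \<Rightarrow> real"
    and alpha :: "'s \<Rightarrow> real ^ 's"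
  assumes "rkhs ev K"
    and "separable_space (euclidean :: 'h topology)"
    and "continuous_on UNIV (\<lambda>(x, y). K x y)"
    and "bounded (range (\<lambda>(x, y). K x y))"
    and "CARD('n) \<ge> 2" and "CARD('m) \<ge> 2" and "CARD('s) \<ge> 2"
    and "\<And>l x. l > 0 \<Longrightarrow> x \<ge> 0 \<Longrightarrow> g l x > 0"
    and "l > 0"
    and "eigensystem
           ((1 / real CARD('s)) *\<^sub>R
             (matrix_sqrt scaled_centering ** gram K Y0 Y0 ** matrix_sqrt scaled_centering))
           lam alpha"
  shows
    "let n = real CARD('n); m = real CARD('m); s = real CARD('s);
         R = (matrix_sqrt scaled_centering :: real ^ 's ^ 's);
         G = (\<Sum>i | lam i \<noteq> 0. ((g l (lam i) - g l 0) / lam i) *\<^sub>R outer (alpha i) (alpha i));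
         Kn = gram K X X; Km = gram K X0 X0;
         Kns = gram K X Y0; Kms = gram K X0 Y0; Kmn = gram K X0 X;
         An = g l 0 *\<^sub>R Kn + (1 / s) *\<^sub>R (Kns ** R ** G ** R ** transpose Kns);
         Am = g l 0 *\<^sub>R Km + (1 / s) *\<^sub>R (Kms ** R ** G ** R ** transpose Kms);
         T1 = inner 1 (An *v 1);
         T2 = trace An;
         T3 = inner 1 (Am *v 1);
         T4 = trace Am;
         T5 = inner 1 ((g l 0 *\<^sub>R Kmn + (1 / s) *\<^sub>R (Kms ** R ** G ** R ** transpose Kns)) *v 1)
     in eta_TS ev K (g l) X X0 Y0 =
          1 / (n * (n - 1)) * (T1 - T2) + 1 / (m * (m - 1)) * (T3 - T4) - 2 / (n * m) * T5"
proof -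
  define R where "R = (matrix_sqrt scaled_centering :: real ^ 's ^ 's)"
  define k where "k = kernel_section ev K"
  define u where "u i = kernel_comb (\<lambda>a. k (Y0 a)) (R *v alpha i)" for i
  define \<psi> where "\<psi> = (\<lambda>i. (1 / sqrt (real CARD('s) * lam i)) *\<^sub>R
    kernel_comb (\<lambda>a. k (Y0 a)) (R *v alpha i))"
  define J where "J = {i. lam i \<noteq> 0}"
  define A where "A = spectral_op (g l 0) J (\<lambda>i. g l (lam i)) \<psi>"
  define G where "G = (\<Sum>i\<in>J. ((g l (lam i) - g l 0) / lam i) *\<^sub>R outer (alpha i) (alpha i))"
  let ?s = "real CARD('s)"
  note cov = emp_cov_spectral_op[OF assms(1,7,10), folded R_def k_def J_def, folded \<psi>_def]
  have lam: "lam i > 0" if "i \<in> J" for i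
    using cov(1)[of i] that by (simp add: J_def)
  have opA: "op_fun (g l) (emp_cov ev K Y0) = A"
    unfolding cov(3) A_def by (rule op_fun_spectral_op[OF cov(2) _ lam]) simp_all
  have inner_sqrt: "inner (op_sqrt A v) (op_sqrt A w) = inner v (A w)" for v w
    unfolding A_def using assms(8)[OF assms(9)] cov(1)
    by (intro inner_op_sqrt_spectral_op cov(2)) (simp_all add: less_imp_le)
  \<comment> \<open>Two point families with independent index types, so that one identity covers
    \<open>An\<close>, \<open>Am\<close> and the mixed matrix of \<open>T5\<close>.\<close>
  have entry: "g l 0 *\<^sub>R gram K U V +
        (1 / ?s) *\<^sub>R (gram K U Y0 ** R ** G ** R ** transpose (gram K V Y0)) =
      (\<chi> p q. inner (k (U p)) (A (k (V q))))"
    for U :: "'p::finite \<Rightarrow> 'x" and V :: "'q::finite \<Rightarrow> 'x"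
  proof -
    have uk: "inner (u i) (k (W p)) = (gram K W Y0 ** R *v alpha i) $ p"
      for W :: "'r::finite \<Rightarrow> 'x" and i p
    proof -
      have "inner (u i) (k (W p)) = (\<Sum>a\<in>UNIV. (R *v alpha i) $ a * inner (k (W p)) (k (Y0 a)))"
        unfolding u_def inner_kernel_comb by (simp add: inner_commute)
      also have "\<dots> = (gram K W Y0 *v (R *v alpha i)) $ p"
        by (simp add: k_def inner_kernel_section[OF assms(1)] gram_def
            matrix_vector_mult_def mult.commute)
      finally show ?thesis by (simp add: matrix_vector_mul_assoc)
    qed
    \<comment> \<open>Symmetry of \<open>R\<close> turns the right-hand factors into a transpose, so
      the outer products in \<open>G\<close> can be pushed through both sides.\<close>
    have "gram K U Y0 ** R ** G ** R ** transpose (gram K V Y0) =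
        (gram K U Y0 ** R) ** G ** transpose (gram K V Y0 ** R)"
      by (simp add: matrix_transpose_mul matrix_mul_assoc R_def
          transpose_matrix_sqrt_scaled_centering)
    also have "\<dots> = (\<Sum>i\<in>J. ((g l (lam i) - g l 0) / lam i) *\<^sub>R
        outer (gram K U Y0 ** R *v alpha i) (gram K V Y0 ** R *v alpha i))"
      unfolding G_def by (rule matrix_mult_sum_outer) simp
    finally have mat: "(gram K U Y0 ** R ** G ** R ** transpose (gram K V Y0)) $ p $ q =
        (\<Sum>i\<in>J. (g l (lam i) - g l 0) / lam i * (inner (u i) (k (U p)) * inner (u i) (k (V q))))"
      for p q
      by (simp add: outer_def uk)
    have "inner (k (U p)) (A (k (V q))) = g l 0 * K (U p) (V q) +
        (\<Sum>i\<in>J. 1 / ?s * ((g l (lam i) - g l 0) / lam i *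
          (inner (u i) (k (U p)) * inner (u i) (k (V q)))))"
      for p q
    proof -
      have "inner (k (U p)) (A (k (V q))) = g l 0 * K (U p) (V q) +
        (\<Sum>i\<in>J. (g l (lam i) - g l 0) * inner (\<psi> i) (k (V q)) * inner (k (U p)) (\<psi> i))"
        by (simp add: A_def spectral_op_def inner_add_right inner_sum_right k_def
            inner_kernel_section[OF assms(1)])
      also have "(\<Sum>i\<in>J. (g l (lam i) - g l 0) * inner (\<psi> i) (k (V q)) * inner (k (U p)) (\<psi> i)) =
        (\<Sum>i\<in>J. 1 / ?s * ((g l (lam i) - g l 0) / lam i *
          (inner (u i) (k (U p)) * inner (u i) (k (V q)))))"
      proof (rule sum.cong[OF refl])
        fix i assume "i \<in> J"
        \<comment> \<open>The normalisations of the two factors \<open>\<psi> i\<close> multiply to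
          \<open>1 / (s * lam i)\<close>, which is where the division by \<open>lam i\<close> in
          \<open>G\<close> comes from.\<close>
        then have "sqrt (?s * lam i) * sqrt (?s * lam i) = ?s * lam i"
          using lam[of i] by simp
        then show "(g l (lam i) - g l 0) * inner (\<psi> i) (k (V q)) * inner (k (U p)) (\<psi> i) =
          1 / ?s * ((g l (lam i) - g l 0) / lam i * (inner (u i) (k (U p)) * inner (u i) (k (V q))))"
          by (simp add: \<psi>_def u_def inner_commute mult_ac)
      qed
      finally show ?thesis .
    qed
    moreover have "gram K U V $ p $ q = K (U p) (V q)" for p q
      by (simp add: gram_def)
    ultimately show ?thesis
      by (simp add: vec_eq_iff mat sum_distrib_left)
  qed
  have "eta_TS ev K (g l) X X0 Y0 =
    1 / (real CARD('n) * (real CARD('n) - 1)) *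
      ((\<Sum>i\<in>UNIV. \<Sum>j\<in>UNIV. inner (k (X i)) (A (k (X j))))
        - (\<Sum>i\<in>UNIV. inner (k (X i)) (A (k (X i))))) +
    1 / (real CARD('m) * (real CARD('m) - 1)) *
      ((\<Sum>i\<in>UNIV. \<Sum>j\<in>UNIV. inner (k (X0 i)) (A (k (X0 j))))
        - (\<Sum>i\<in>UNIV. inner (k (X0 i)) (A (k (X0 i))))) -
    2 / (real CARD('n) * real CARD('m)) * (\<Sum>i\<in>UNIV. \<Sum>j\<in>UNIV. inner (k (X0 i)) (A (k (X j))))"
    unfolding eta_TS_def Let_def opA k_def[symmetric] inner_sqrt
    by (rule sum_offdiag_form)
      (simp_all add: A_def linear_spectral_op spectral_op_sym assms(5,6))
  then show ?thesis
    unfolding Let_def R_def[symmetric] J_def[symmetric] G_def[symmetric] entry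
      inner_one_matrix_one trace_def by simp
qed

end
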